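(* Let $q\in[0,1]$ and $\delta_j\ge0$ for $1\le j\le p$, and consider testing the two-sided null hypotheses $\breve{\mathsf H}_{0,j}:|\beta_j|\le\delta_j$, $1\le j\le p$. Let $\mathcal R'_{q/2}$ and $\mathcal R''_{q/2}$ be the rejection sets (defined in the context) of the one-sided shifted-OLS knockoff procedures with target FDR $q/2$ for testing $\mathsf H'_{0,j}:\beta_j\le\delta_j$ and $\mathsf H''_{0,j}:\beta_j\ge-\delta_j$, respectively. Then rejecting $\mathcal R=\mathcal R'_{q/2}\cup\mathcal R''_{q/2}$ controls the FDR at level $q$, i.e. $$\mathsf{FDR}=\mathbb E\left(\frac{|\mathcal R\cap\breve{\mathcal H}_0|}{|\mathcal R|\vee1}\right)\le q,$$ where $\breve{\mathcal H}_0=\mathcal H_0'\cap\mathcal H_0''$ with $\mathcal H_0'=\{j:\beta_j\le\delta_j\}$ and $\mathcal H_0''=\{j:\beta_j\ge-\delta_j\}$.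
   Context: Model: $\mathbf y=\mathbf X\boldsymbol\beta+\mathbf w$ with $\mathbf w\sim\mathcal N(0,\sigma^2\mathbf I_n)$, $\sigma^2>0$, $\mathbf X=[\mathbf X_1,\dots,\mathbf X_p]\in\mathbb R^{n\times p}$ a fixed (deterministic) design with $n\ge 2p$, columns of Euclidean norm $1$, and $\boldsymbol\Sigma=\mathbf X^\top\mathbf X$ invertible; $\boldsymbol\beta=(\beta_1,\dots,\beta_p)^\top\in\mathbb R^p$ is a fixed unknown vector. Knockoff matrix: fix $\mathbf s\in\mathbb R^p_+$ with $\mathrm{diag}(\mathbf s)\preceq 2\boldsymbol\Sigma$, and let $\tilde{\mathbf X}=\mathbf X(\mathbf I_p-\boldsymbol\Sigma^{-1}\mathrm{diag}(\mathbf s))+\tilde{\mathbf U}\mathbf C$, where $\tilde{\mathbf U}\in\mathbb R^{n\times p}$ has orthonormal columns with $\tilde{\mathbf U}^\top\mathbf X=0$, and $\mathbf C^\top\mathbf C=2\,\mathrm{diag}(\mathbf s)-\mathrm{diag}(\mathbf s)\boldsymbol\Sigma^{-1}\mathrm{diag}(\mathbf s)$. Then $$\mathbf G=[\mathbf X\ \tilde{\mathbf X}]^\top[\mathbf X\ \tilde{\mathbf X}]=\begin{bmatrix}\boldsymbol\Sigma&\boldsymbol\Sigma-\mathrm{diag}(\mathbf s)\\ \boldsymbol\Sigma-\mathrm{diag}(\mathbf s)&\boldsymbol\Sigma\end{bmatrix},$$ and $\mathbf G$ is assumed invertible. Let $\hat{\boldsymbol\beta}_{\mathsf{OLS}}=\mathbf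 G^{-1}[\mathbf X\ \tilde{\mathbf X}]^\top\mathbf y\in\mathbb R^{2p}$ and $\boldsymbol\delta=(\delta_1,\dots,\delta_p)^\top$. Knockoff procedure with target FDR $\tau$: given real statistics $W_1,\dots,W_p$, let $\Phi=\{|W_j|:1\le j\le p\}\setminus\{0\}$ and $$T=\inf\Big\{t\in\Phi:\frac{1+\#\{j:W_j\le -t\}}{\#\{j:W_j\ge t\}\vee 1}\le \tau\Big\}$$ (with $\inf\emptyset=+\infty$); the procedure rejects $\{j:W_j\ge T\}$. One-sided procedures: $\mathcal R'_{q/2}$ is the rejection set of the knockoff procedure with target FDR $\tau=q/2$ applied to statistics $W_j$ computed from $\hat{\boldsymbol\beta}_{\mathsf{S\text{-}OLS}}=\hat{\boldsymbol\beta}_{\mathsf{OLS}}+\begin{pmatrix}\mathbf 0\\ \boldsymbol\delta\end{pmatrix}$, where, writing $\hat\beta_j,\hat\beta_j'$ for the $j$-th and $(j+p)$-th entries of $\hat{\boldsymbol\beta}_{\mathsf{S\text{-}OLS}}$, for every $j$ the magnitude $|W_j|$ depends on the estimator only through the unordered pair $\{\hat\beta_j,\hat\beta_j'\}$ and $\mathrm{sgn}(W_j)=\mathrm{sgn}(\hat\beta_j-\hat\beta_j')$ (with $\mathrm{sgn}(0)=0$). The set $\mathcal R''_{q/2}$ is defined in the same way, but with $\hat{\boldsymbol\beta}_{\mathsf{S\text{-}OLS}}=-\hat{\boldsymbol\beta}_{\mathsf{OLS}}+\begin{pmatrix}\mathbf 0\\ \boldsymbol\delta\end{pmatrix}$.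 *)

theory Defs
  imports "HOL-Probability.Probability"
begin

text \<open>
  An \<open>n \<times> p\<close> matrix has type \<open>real ^ 'p ^ 'n\<close>. Vectors in \<open>\<real>\<^sup>2\<^sup>p\<close> are indexed by \<open>'p + 'p\<close>: the index
  \<open>Inl j\<close> stands for position \<open>j\<close> (original variable) and \<open>Inr j\<close> for position \<open>j + p\<close> (knockoff).
\<close>

definition diag_mat :: "real ^ 'p \<Rightarrow> real ^ 'p ^ 'p" where
  "diag_mat s = (\<chi> i j. if i = j then s $ i else 0)"

definition psd :: "real ^ 'p ^ 'p \<Rightarrow> bool" where
  "psd A \<longleftrightarrow> transpose A = A \<and> (\<forall>x. 0 \<le> x \<bullet> (A *v x))"

definition loewner_le :: "real ^ 'p ^ 'p \<Rightarrow> real ^ 'p ^ 'p \<Rightarrow> bool" where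
  "loewner_le A B \<longleftrightarrow> psd (B - A)"

definition gram :: "real ^ 'k ^ 'n \<Rightarrow> real ^ 'k ^ 'k" where
  "gram A = transpose A ** A"

definition hconcat :: "real ^ 'p ^ 'n \<Rightarrow> real ^ 'q ^ 'n \<Rightarrow> real ^ ('p + 'q) ^ 'n" where
  "hconcat A B = (\<chi> i k. case k of Inl j \<Rightarrow> A $ i $ j | Inr j \<Rightarrow> B $ i $ j)"

definition knockoff_matrix ::
    "real ^ 'p ^ 'n \<Rightarrow> real ^ 'p \<Rightarrow> real ^ 'p ^ 'n \<Rightarrow> real ^ 'p ^ 'p \<Rightarrow> real ^ 'p ^ 'n" where
  "knockoff_matrix X s U C =
     X ** (mat 1 - matrix_inv (gram X) ** diag_mat s) + U ** C"

definition is_knockoff_factor ::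
    "real ^ 'p ^ 'n \<Rightarrow> real ^ 'p \<Rightarrow> real ^ 'p ^ 'n \<Rightarrow> real ^ 'p ^ 'p \<Rightarrow> bool" where
  "is_knockoff_factor X s U C \<longleftrightarrow>
     transpose U ** U = mat 1 \<and>
     transpose U ** X = 0 \<and>
     transpose C ** C =
       2 *\<^sub>R diag_mat s - diag_mat s ** matrix_inv (gram X) ** diag_mat s"

definition ols :: "real ^ 'k ^ 'n \<Rightarrow> real ^ 'n \<Rightarrow> real ^ 'k" where
  "ols A y = matrix_inv (gram A) *v (transpose A *v y)"

definition knockoff_shift :: "real ^ 'p \<Rightarrow> real ^ ('p + 'p)" where
  "knockoff_shift \<delta> = (\<chi> k. case k of Inl j \<Rightarrow> 0 | Inr j \<Rightarrow> \<delta> $ j)"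

text \<open>The Lebesgue density of \<open>\<N>(0, \<sigma>\<^sup>2 I\<^sub>n)\<close>.\<close>

definition iso_normal_density :: "real \<Rightarrow> real ^ 'n \<Rightarrow> real" where
  "iso_normal_density \<sigma> x =
     1 / sqrt (2 * pi * \<sigma>\<^sup>2) ^ CARD('n) * exp (- (norm x)\<^sup>2 / (2 * \<sigma>\<^sup>2))"

text \<open>
  A rule computing the statistics \<open>(W\<^sub>1, \<dots>, W\<^sub>p)\<close> from a \<open>2p\<close>-dimensional estimate. The set
  \<open>{b $ Inl j, b $ Inr j}\<close> represents the unordered pair, so the first clause about \<open>j\<close> says that
  \<open>\<bar>W\<^sub>j\<bar>\<close> is a function of that pair only. Measurability makes the statistics random variables.
\<close>

definition knockoff_statistic :: "(real ^ ('p + 'p) \<Rightarrow> real ^ 'p) \<Rightarrow> bool" where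
  "knockoff_statistic W \<longleftrightarrow>
     W \<in> borel_measurable borel \<and>
     (\<forall>j. (\<forall>b b'. {b $ Inl j, b $ Inr j} = {b' $ Inl j, b' $ Inr j} \<longrightarrow>
                   \<bar>W b $ j\<bar> = \<bar>W b' $ j\<bar>) \<and>
          (\<forall>b. sgn (W b $ j) = sgn (b $ Inl j - b $ Inr j)))"

text \<open>The threshold is extended-real valued, so that the infimum of the empty set is \<open>\<infinity>\<close>.\<close>

definition knockoff_threshold :: "real \<Rightarrow> real ^ 'p \<Rightarrow> ereal" where
  "knockoff_threshold \<tau> W =
     Inf (ereal ` {t \<in> {\<bar>W $ j\<bar> |j. True} - {0}.
       (1 + real (card {j. W $ j \<le> - t})) / real (max (card {j. W $ j \<ge> t}) 1) \<le> \<tau>})"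

definition knockoff_select :: "real \<Rightarrow> real ^ 'p \<Rightarrow> 'p set" where
  "knockoff_select \<tau> W = {j. ereal (W $ j) \<ge> knockoff_threshold \<tau> W}"

definition fdp :: "'p set \<Rightarrow> 'p set \<Rightarrow> real" where
  "fdp R H0 = real (card (R \<inter> H0)) / real (max (card R) 1)"

definition fdr :: "'a measure \<Rightarrow> ('a \<Rightarrow> 'p set) \<Rightarrow> 'p set \<Rightarrow> real" where
  "fdr M R H0 = (\<integral>\<omega>. fdp (R \<omega>) H0 \<partial>M)"

end

theory Submission
  imports Defs
begin

text \<open>
  The false discovery proportion of a union is at most the sum of the two one-sided ones, so it
  suffices to control each one-sided procedure at level \<open>q / 2\<close>. With \<open>T\<close> the threshold, the
  false discovery proportion is at most \<open>q / 2\<close> times the number of nulls with \<open>W\<^sub>j \<ge> T\<close>, divided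
  by one plus the number of nulls with \<open>W\<^sub>j \<le> - T\<close>. Instead of a martingale argument, each summand
  of this ratio is treated by leaving one sign out: let \<open>T\<^sub>j\<close> be the threshold after \<open>W\<^sub>j\<close> has been
  replaced by \<open>\<bar>W\<^sub>j\<bar>\<close>. It equals \<open>T\<close> if \<open>W\<^sub>j \<ge> T\<close>, it does not change when the sign of \<open>W\<^sub>j\<close> is
  flipped, and all \<open>j\<close> with \<open>W\<^sub>j \<le> - T\<^sub>j\<close> share the same \<open>T\<^sub>j\<close>. Flipping a null from plus to minus
  does not decrease expectations, and after the flip the sum over the nulls is at most 1.

  The flip is realised in the noise space: exchanging the two coordinates of the \<open>j\<close>-th pair of the
  shifted estimate corresponds to the reflection of the noise in an affine hyperplane orthogonal to
  \<open>X\<^sub>j - Xt\<^sub>j\<close>. Under the null hypothesis the origin lies on the nonpositive side of this hyperplane,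
  so the Gaussian density of the noise is larger there.
\<close>

subsection \<open>Combinatorics of the knockoff threshold\<close>

definition admissible :: "real \<Rightarrow> real ^ 'p \<Rightarrow> real \<Rightarrow> bool" where
  "admissible \<tau> v t \<longleftrightarrow> t \<in> {\<bar>v $ j\<bar> |j. True} - {0} \<and>
     (1 + real (card {j. v $ j \<le> - t})) / real (max (card {j. v $ j \<ge> t}) 1) \<le> \<tau>"

lemma admissible_pos: "admissible \<tau> v t \<Longrightarrow> 0 < t"
  by (auto simp: admissible_def)

lemma knockoff_threshold_eq: "knockoff_threshold \<tau> v = Inf (ereal ` {t. admissible \<tau> v t})"
  unfolding knockoff_threshold_def admissible_def by (simp add: Collect_conj_eq)

lemma finite_admissible: "finite {t. admissible \<tau> (v :: real ^ 'p) t}"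
proof (rule finite_subset)
  show "{t. admissible \<tau> v t} \<subseteq> range (\<lambda>j. \<bar>v $ j\<bar>)"
    by (auto simp: admissible_def)
qed simp

lemma knockoff_threshold_le: "admissible \<tau> v t \<Longrightarrow> knockoff_threshold \<tau> v \<le> ereal t"
  unfolding knockoff_threshold_eq by (rule Inf_lower) simp

text \<open>Every candidate is one of the finitely many magnitudes, so the infimum is attained
  unless no candidate exists. A finite threshold therefore satisfies the ratio bound itself and is
  positive.\<close>

lemma knockoff_threshold_cases:
  obtains (empty) "knockoff_threshold \<tau> v = \<infinity>"
  | (attained) t where "knockoff_threshold \<tau> v = ereal t" "admissible \<tau> v t" "0 < t"
proof (cases "{t. admissible \<tau> v t} = {}")
  case True
  have "knockoff_threshold \<tau> v = \<infinity>"
    unfolding knockoff_threshold_eq True by (simp add: top_ereal_def)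
  then show ?thesis by (rule empty)
next
  case False
  define A where "A = ereal ` {t. admissible \<tau> v t}"
  have "finite A" "A \<noteq> {}" using False finite_admissible by (auto simp: A_def)
  then have "Inf A \<in> A" by (simp add: Min_Inf[symmetric])
  then show ?thesis
    using attained unfolding A_def knockoff_threshold_eq[symmetric]
    by (auto dest: admissible_pos)
qed

definition abs_at :: "'p \<Rightarrow> real ^ 'p \<Rightarrow> real ^ 'p" where
  "abs_at j v = (\<chi> k. if k = j then \<bar>v $ j\<bar> else v $ k)"

lemma abs_at_nth: "abs_at j v $ k = (if k = j then \<bar>v $ j\<bar> else v $ k)"
  by (simp add: abs_at_def)

lemma abs_at_id: "0 \<le> v $ j \<Longrightarrow> abs_at j v = v"
  by (simp add: abs_at_def vec_eq_iff)

text \<open>Either modification moves exactly one index from the lower tail at \<open>- t\<close> to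
  the upper tail at \<open>t\<close> and keeps all magnitudes. Hence both counts in the ratio agree
  for \<open>j\<close> and \<open>k\<close>.\<close>

lemma admissible_abs_at:
  assumes "v $ j \<le> - t" "v $ k \<le> - t" "admissible \<tau> (abs_at j v) t"
  shows "admissible \<tau> (abs_at k v) t"
proof -
  have t: "0 < t" using assms(3) by (rule admissible_pos)
  have below: "{i. abs_at l v $ i \<le> - t} = {i. v $ i \<le> - t} - {l}"
    and above: "{i. abs_at l v $ i \<ge> t} = insert l {i. v $ i \<ge> t}" if "v $ l \<le> - t" for l
    using t that by (auto simp: abs_at_nth split: if_splits)
  have "card {i. abs_at l v $ i \<le> - t} = card {i. v $ i \<le> - t} - 1"
    "card {i. abs_at l v $ i \<ge> t} = Suc (card {i. v $ i \<ge> t})" if "v $ l \<le> - t" for l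
    using that t unfolding below[OF that] above[OF that] by (auto simp: card_Diff_singleton)
  note cards = this[OF assms(1)] this[OF assms(2)]
  have "{\<bar>abs_at l v $ i\<bar> |i. True} = {\<bar>v $ i\<bar> |i. True}" for l
    by (auto simp: abs_at_nth)
  then show ?thesis
    using assms(3) unfolding admissible_def cards by simp
qed

lemma threshold_abs_at_eq:
  assumes j: "ereal (v $ j) \<le> - knockoff_threshold \<tau> (abs_at j v)"
    and k: "ereal (v $ k) \<le> - knockoff_threshold \<tau> (abs_at k v)"
  shows "knockoff_threshold \<tau> (abs_at j v) = knockoff_threshold \<tau> (abs_at k v)"
proof -
  \<comment> \<open>It suffices to start from the smaller threshold \<open>t\<close>: the other
    statistic is then below \<open>- t\<close> as well, so \<open>t\<close> is admissible for the
    other modification too.\<close>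
  have le: "knockoff_threshold \<tau> (abs_at k v) \<le> knockoff_threshold \<tau> (abs_at j v)"
    if j: "ereal (v $ j) \<le> - knockoff_threshold \<tau> (abs_at j v)"
      and k: "ereal (v $ k) \<le> - knockoff_threshold \<tau> (abs_at k v)"
      and jk: "knockoff_threshold \<tau> (abs_at j v) \<le> knockoff_threshold \<tau> (abs_at k v)" for j k
  proof (cases rule: knockoff_threshold_cases[of \<tau> "abs_at j v"])
    case (attained t)
    have "ereal (v $ k) \<le> - ereal t"
      using k jk unfolding attained(1) by (meson ereal_minus_le_minus order_trans)
    then show ?thesis
      using j attained admissible_abs_at[of v j t k \<tau>] by (auto intro: knockoff_threshold_le)
  qed (use j in simp)
  show ?thesis
    using le[OF j k] le[OF k j] by (meson antisym linear)
qed

text \<open>The leave-one-out weight of \<open>j\<close> ignores the sign of the \<open>j\<close>-th statistic, so that a sign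
  flip at a null \<open>j\<close> can be performed with the weight held fixed.\<close>

definition flip_weight :: "real \<Rightarrow> 'p set \<Rightarrow> 'p \<Rightarrow> real ^ 'p \<Rightarrow> real" where
  "flip_weight \<tau> H j v =
     (if knockoff_threshold \<tau> (abs_at j v) \<le> ereal \<bar>v $ j\<bar> then 1 else 0) /
     (1 + real (card {k \<in> H. ereal (abs_at j v $ k) \<le> - knockoff_threshold \<tau> (abs_at j v)}))"

lemma flip_weight_nonneg: "0 \<le> flip_weight \<tau> H j v"
  by (simp add: flip_weight_def)

lemma flip_weight_cong:
  assumes "abs_at j v = abs_at j v'"
  shows "flip_weight \<tau> H j v = flip_weight \<tau> H j v'"
proof -
  have "\<bar>v $ j\<bar> = \<bar>v' $ j\<bar>"
    using arg_cong[OF assms, of "\<lambda>u. u $ j"] unfolding abs_at_nth by simp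
  then show ?thesis unfolding flip_weight_def assms by simp
qed

text \<open>Restricting the lower count to \<open>H\<close> only shrinks it, so the ratio bound at
  the threshold survives with \<open>N\<close>. A selected statistic is positive,
  \<open>abs_at\<close> leaves it alone, and its weight is exactly
  \<open>1 / (1 + N)\<close>.\<close>

lemma fdp_knockoff_select_le:
  assumes "0 \<le> \<tau>"
  shows "fdp (knockoff_select \<tau> v) H \<le> \<tau> * (\<Sum>j\<in>H. if 0 < v $ j then flip_weight \<tau> H j v else 0)"
proof (cases rule: knockoff_threshold_cases[of \<tau> v])
  case empty
  then show ?thesis
    using assms by (auto simp: fdp_def knockoff_select_def flip_weight_nonneg intro!: mult_nonneg_nonneg sum_nonneg)
next
  case (attained t)
  define S where "S = {j. t \<le> v $ j}"
  have S: "knockoff_select \<tau> v = S"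
    by (simp add: knockoff_select_def attained S_def)
  define N where "N = card {k \<in> H. v $ k \<le> - t}"
  have "N \<le> card {k. v $ k \<le> - t}"
    unfolding N_def by (rule card_mono) auto
  then have N: "(1 + real N) / real (max (card S) 1) \<le> \<tau>"
    using attained(2) unfolding admissible_def S_def
    by (intro order_trans[OF divide_right_mono[of "1 + real N" "1 + real (card {k. v $ k \<le> - t})"]]) auto
  have weight: "flip_weight \<tau> H j v = 1 / (1 + real N)" if "j \<in> S" for j
    using that attained(3) by (simp add: S_def flip_weight_def abs_at_id attained(1) N_def)
  have "fdp (knockoff_select \<tau> v) H = ((1 + real N) / real (max (card S) 1)) * (real (card (S \<inter> H)) / (1 + real N))"
    unfolding fdp_def S by simp
  also have "\<dots> \<le> \<tau> * (real (card (S \<inter> H)) / (1 + real N))"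
    by (rule mult_right_mono[OF N]) simp
  also have "real (card (S \<inter> H)) / (1 + real N) = (\<Sum>j\<in>S \<inter> H. if 0 < v $ j then flip_weight \<tau> H j v else 0)"
    using attained(3) by (simp add: weight S_def cong: sum.cong_simp)
  also have "\<dots> \<le> (\<Sum>j\<in>H. if 0 < v $ j then flip_weight \<tau> H j v else 0)"
    by (rule sum_mono2) (auto simp: flip_weight_nonneg)
  finally show ?thesis using assms by (auto simp: mult_left_mono)
qed

text \<open>Only indices in \<open>J\<close> carry weight, and they share one threshold. Each of
  them therefore counts all the others in its denominator, which is at least the size of
  \<open>J\<close>.\<close>

lemma sum_negative_flip_weight_le:
  "(\<Sum>j\<in>H. if v $ j < 0 then flip_weight \<tau> H j v else 0) \<le> 1"
proof -
  let ?T = "\<lambda>j. knockoff_threshold \<tau> (abs_at j v)"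
  define J where "J = {j \<in> H. v $ j < 0 \<and> ereal (v $ j) \<le> - ?T j}"
  have J_iff: "?T j \<le> ereal (- (v $ j)) \<longleftrightarrow> ereal (v $ j) \<le> - ?T j" if "v $ j < 0" for j
    using that by (cases "?T j") auto
  have "(\<Sum>j\<in>H. if v $ j < 0 then flip_weight \<tau> H j v else 0) = (\<Sum>j\<in>J. flip_weight \<tau> H j v)"
    unfolding J_def by (rule sum.mono_neutral_cong_right) (auto simp: flip_weight_def J_iff)
  also have "\<dots> \<le> (\<Sum>j\<in>J. 1 / real (card J))"
  proof (rule sum_mono)
    fix j assume j: "j \<in> J"
    then obtain t where t: "?T j = ereal t" "0 < t"
      by (cases rule: knockoff_threshold_cases[of \<tau> "abs_at j v"]) (auto simp: J_def)
    have "v $ k \<le> - t" if "k \<in> J" for k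
    proof -
      have "?T k = ereal t" "ereal (v $ k) \<le> - ?T k"
        using threshold_abs_at_eq[of v j \<tau> k] j that t by (simp_all add: J_def)
      then show ?thesis by simp
    qed
    \<comment> \<open>The index \<open>j\<close> is missing because \<open>abs_at\<close> makes its
      entry nonnegative; the summand 1 in the denominator of the weight makes up for it.\<close>
    then have "J - {j} \<subseteq> {k \<in> H. ereal (abs_at j v $ k) \<le> - ?T j}"
      by (auto simp: t abs_at_nth J_def)
    then have "card (J - {j}) \<le> card {k \<in> H. ereal (abs_at j v $ k) \<le> - ?T j}"
      by (rule card_mono[rotated]) simp
    then have "card J \<le> 1 + card {k \<in> H. ereal (abs_at j v $ k) \<le> - ?T j}"
      using j by (simp add: card_Diff_singleton)
    moreover have "0 < card J" using j by (auto simp: card_gt_0_iff)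
    ultimately show "flip_weight \<tau> H j v \<le> 1 / real (card J)"
      unfolding flip_weight_def by (auto intro!: frac_le simp del: of_nat_Suc)
  qed
  also have "\<dots> \<le> 1" by simp
  finally show ?thesis .
qed

text \<open>Numerators are subadditive, and enlarging the rejection set in a denominator only
  decreases each fraction.\<close>

lemma fdp_Un_le: "fdp (R \<union> R') (H \<inter> H') \<le> fdp R H + fdp R' (H' :: 'p::finite set)"
proof -
  have "real (card ((R \<union> R') \<inter> (H \<inter> H'))) \<le> real (card (R \<inter> H)) + real (card (R' \<inter> H'))"
    unfolding of_nat_add[symmetric] of_nat_le_iff
    by (rule order_trans[OF card_mono card_Un_le]) auto
  then have "fdp (R \<union> R') (H \<inter> H') \<le> (real (card (R \<inter> H)) + real (card (R' \<inter> H'))) / real (max (card (R \<union> R')) 1)"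
    unfolding fdp_def by (rule divide_right_mono) simp
  also have "\<dots> \<le> fdp R H + fdp R' H'"
    unfolding fdp_def add_divide_distrib
    by (intro add_mono divide_left_mono of_nat_mono max.mono card_mono) auto
  finally show ?thesis .
qed

section \<open>Measurability of the threshold and of the weights\<close>

lemma card_measurable [measurable]:
  fixes P :: "'p::finite \<Rightarrow> 'a \<Rightarrow> bool"
  assumes [measurable]: "\<And>k. Measurable.pred M (P k)"
  shows "(\<lambda>x. real (card {k. P k x})) \<in> borel_measurable M"
proof -
  have "real (card {k. P k x}) = (\<Sum>k\<in>UNIV. if P k x then 1 else 0)" for x
    by (simp add: sum.If_cases)
  then show ?thesis by simp
qed

lemma vec_nth_measurable [measurable]: "(\<lambda>v. v $ j) \<in> borel_measurable (borel :: (real ^ 'p) measure)"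
  by (intro borel_measurable_continuous_onI continuous_intros)

lemma knockoff_threshold_measurable [measurable]:
  "knockoff_threshold \<tau> \<in> borel_measurable (borel :: (real ^ 'p) measure)"
proof -
  \<comment> \<open>The candidate set depends on \<open>v\<close>. Indexing by coordinates, with
    value \<infinity> for inadmissible ones, gives an infimum of finitely many measurable
    functions.\<close>
  have eq: "knockoff_threshold \<tau> v = (INF i. if admissible \<tau> v \<bar>v $ i\<bar> then ereal \<bar>v $ i\<bar> else \<infinity>)" for v :: "real ^ 'p"
    unfolding knockoff_threshold_eq
  proof (rule antisym)
    show "Inf (ereal ` {t. admissible \<tau> v t}) \<le> (INF i. if admissible \<tau> v \<bar>v $ i\<bar> then ereal \<bar>v $ i\<bar> else \<infinity>)"
      by (rule INF_greatest) (auto intro: Inf_lower)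
    show "(INF i. if admissible \<tau> v \<bar>v $ i\<bar> then ereal \<bar>v $ i\<bar> else \<infinity>) \<le> Inf (ereal ` {t. admissible \<tau> v t})"
    proof (rule Inf_greatest)
      fix x assume "x \<in> ereal ` {t. admissible \<tau> v t}"
      then obtain t where t: "x = ereal t" "admissible \<tau> v t" by blast
      moreover obtain i where "t = \<bar>v $ i\<bar>" using t(2) by (auto simp: admissible_def)
      ultimately have "x = ereal \<bar>v $ i\<bar>" "admissible \<tau> v \<bar>v $ i\<bar>" by auto
      then show "(INF i. if admissible \<tau> v \<bar>v $ i\<bar> then ereal \<bar>v $ i\<bar> else \<infinity>) \<le> x"
        by (intro INF_lower2[of i]) auto
    qed
  qed
  have [measurable]: "Measurable.pred borel (\<lambda>v :: real ^ 'p. admissible \<tau> v \<bar>v $ i\<bar>)" for i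
  proof -
    have "admissible \<tau> v \<bar>v $ i\<bar> \<longleftrightarrow> v $ i \<noteq> 0 \<and>
      (1 + real (card {j. v $ j \<le> - \<bar>v $ i\<bar>})) / max (real (card {j. v $ j \<ge> \<bar>v $ i\<bar>})) 1 \<le> \<tau>" for v :: "real ^ 'p"
      by (auto simp: admissible_def of_nat_max)
    then show ?thesis by simp
  qed
  show ?thesis
    unfolding eq[abs_def] by (intro borel_measurable_INF) auto
qed

lemma abs_at_measurable [measurable]: "abs_at j \<in> borel_measurable (borel :: (real ^ 'p) measure)"
  unfolding abs_at_def[abs_def]
proof (intro borel_measurable_continuous_onI continuous_on_vec_lambda)
  show "continuous_on UNIV (\<lambda>v :: real ^ 'p. if k = j then \<bar>v $ j\<bar> else v $ k)" for k
    by (cases "k = j") (auto intro!: continuous_intros)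
qed

lemma flip_weight_measurable [measurable]:
  "flip_weight \<tau> H j \<in> borel_measurable (borel :: (real ^ 'p) measure)"
  unfolding flip_weight_def[abs_def] by measurable

subsection \<open>Reflections of Lebesgue measure\<close>

text \<open>The change of variables theorems of the library require a well-ordered index type of the
  coordinates. Exhausting an open set by disjoint balls (Vitali) needs no such order.\<close>

lemma emeasure_isometry_image:
  fixes f g :: "'a::euclidean_space \<Rightarrow> 'a"
  assumes dist: "\<And>x y. dist (f x) (f y) = dist x y"
    and gf: "\<And>x. g (f x) = x" and fg: "\<And>x. f (g x) = x"
    and S: "open S"
  shows "emeasure lborel (f ` S) = emeasure lborel S"
proof -
  have distg: "dist (g x) (g y) = dist x y" for x y
    using dist[of "g x" "g y"] by (simp add: fg)
  have cont: "continuous_on UNIV g"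
    unfolding continuous_on_iff by (auto simp: distg)
  have image: "f ` T = g -` T" for T
    using gf fg by (auto simp: image_iff) metis
  have open_image: "open (f ` T)" if "open T" for T
    unfolding image using cont that by (simp add: continuous_on_open_vimage[of UNIV])
  have ball_image: "f ` ball a r = ball (f a) r" for a r
    unfolding image by (auto simp: mem_ball) (metis dist fg)+
  define K where "K = {k :: 'a \<times> real. ball (fst k) (snd k) \<subseteq> S}"
  obtain I where I: "countable I" "I \<subseteq> K"
      "pairwise (\<lambda>i j. disjnt (ball (fst i) (snd i)) (ball (fst j) (snd j))) I"
      "negligible (S - (\<Union>i\<in>I. ball (fst i) (snd i)))"
  proof (rule Vitali_covering_theorem_balls[of S K fst snd])
    fix x and d :: real
    assume "x \<in> S" "0 < d"
    then obtain e where e: "e > 0" "ball x e \<subseteq> S" using S by (meson openE)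
    show "\<exists>i. i \<in> K \<and> x \<in> ball (fst i) (snd i) \<and> snd i < d"
      \<comment> \<open>The radius is positive, keeps the ball inside \<open>S\<close> and is
        smaller than \<open>d\<close>.\<close>
      by (rule exI[of _ "(x, min e (d / 2))"]) (use e \<open>0 < d\<close> in \<open>auto simp: K_def\<close>)
  qed
  define B where "B = (\<Union>i\<in>I. ball (fst i) (snd i))"
  have disj: "disjoint_family_on (\<lambda>i. ball (fst i) (snd i)) I"
    using I(3) by (auto simp: disjoint_family_on_def pairwise_def disjnt_def)
  have "disjoint_family_on (\<lambda>i. f ` ball (fst i) (snd i)) I"
    using disj unfolding image disjoint_family_on_def by blast
  then have disj': "disjoint_family_on (\<lambda>i. ball (f (fst i)) (snd i)) I"
    by (simp only: ball_image)
  have "open B" unfolding B_def by auto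
  have "B \<subseteq> S" using I(2) unfolding B_def K_def by blast
  have union: "emeasure lborel T = emeasure lborel V"
    if "open T" "open V" "V \<subseteq> T" "negligible (T - V)" for T V :: "'a set"
  proof -
    have "emeasure lborel (V \<union> (T - V)) = emeasure lborel V"
      using that
      by (intro emeasure_Un_null_set) (auto simp: null_sets_def negligible_iff_emeasure0)
    moreover have "V \<union> (T - V) = T" using that(3) by blast
    ultimately show ?thesis by simp
  qed
  \<comment> \<open>An isometry is Lipschitz with constant 1, so it preserves negligible
    sets.\<close>
  have "negligible (f ` (S - B))"
    by (rule negligible_locally_Lipschitz_image)
      (use I(4) dist in \<open>auto simp: B_def dist_norm intro!: exI[of _ UNIV] exI[of _ 1]\<close>)
  moreover have "f ` (S - B) = f ` S - f ` B" unfolding image by blast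
  ultimately have "emeasure lborel (f ` S) = emeasure lborel (f ` B)"
    using S \<open>open B\<close> \<open>B \<subseteq> S\<close> by (intro union open_image) auto
  also have "f ` B = (\<Union>i\<in>I. ball (f (fst i)) (snd i))"
    by (simp add: B_def image_UN ball_image)
  also have "emeasure lborel \<dots> = (\<integral>\<^sup>+i. emeasure lborel (ball (f (fst i)) (snd i)) \<partial>count_space I)"
    by (rule emeasure_UN_countable) (use I(1) disj' in auto)
  also have "\<dots> = (\<integral>\<^sup>+i. emeasure lborel (ball (fst i) (snd i)) \<partial>count_space I)"
  proof (rule nn_integral_cong)
    fix i
    show "emeasure lborel (ball (f (fst i)) (snd i)) = emeasure lborel (ball (fst i) (snd i))"
      \<comment> \<open>Pairs in \<open>K\<close> may have a negative radius; both balls are then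
        empty.\<close>
      by (cases "snd i \<ge> 0") (simp_all add: emeasure_ball ball_empty)
  qed
  also have "\<dots> = emeasure lborel B"
    unfolding B_def by (rule emeasure_UN_countable[symmetric]) (use I(1) disj in auto)
  also have "\<dots> = emeasure lborel S"
    by (rule union[symmetric]) (use S \<open>open B\<close> \<open>B \<subseteq> S\<close> I(4) in \<open>auto simp: B_def\<close>)
  finally show ?thesis .
qed

text \<open>Lebesgue measure is determined by its values on open boxes. The preimage of a box under
  \<open>f\<close> is its image under the inverse isometry \<open>g\<close>, which has the same
  measure.\<close>

lemma distr_lborel_isometry:
  fixes f g :: "'a::euclidean_space \<Rightarrow> 'a"
  assumes dist: "\<And>x y. dist (f x) (f y) = dist x y"
    and gf: "\<And>x. g (f x) = x" and fg: "\<And>x. f (g x) = x"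
  shows "distr lborel borel f = lborel"
proof (rule lborel_eqI[symmetric])
  have cont: "continuous_on UNIV f"
    unfolding continuous_on_iff by (auto simp: dist)
  then have meas: "f \<in> borel_measurable lborel"
    by (simp add: borel_measurable_continuous_onI)
  have distg: "dist (g x) (g y) = dist x y" for x y
    using dist[of "g x" "g y"] by (simp add: fg)
  fix l u :: 'a assume "\<And>b. b \<in> Basis \<Longrightarrow> l \<bullet> b \<le> u \<bullet> b"
  have "f -` box l u = g ` box l u"
    using gf fg by (auto simp: image_iff) metis
  then show "emeasure (distr lborel borel f) (box l u) = (\<Prod>b\<in>Basis. (u - l) \<bullet> b)"
    using emeasure_isometry_image[of g f "box l u", OF distg fg gf open_box] \<open>\<And>b. b \<in> Basis \<Longrightarrow> l \<bullet> b \<le> u \<bullet> b\<close> meas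
    by (simp add: emeasure_distr emeasure_lborel_box)
qed simp

text \<open>For nonzero \<open>a\<close> this is the orthogonal reflection in the affine hyperplane
  of all \<open>x\<close> with \<open>a \<bullet> x = m\<close>.\<close>

definition reflect :: "'a::real_inner \<Rightarrow> real \<Rightarrow> 'a \<Rightarrow> 'a" where
  "reflect a m x = x - (2 * (a \<bullet> x - m) / (a \<bullet> a)) *\<^sub>R a"

lemma inner_reflect: "a \<noteq> 0 \<Longrightarrow> a \<bullet> reflect a m x = 2 * m - a \<bullet> x"
  by (simp add: reflect_def inner_diff_right)

lemma reflect_reflect:
  assumes "a \<noteq> 0"
  shows "reflect a m (reflect a m x) = x"
proof -
  have "2 * (a \<bullet> reflect a m x - m) / (a \<bullet> a) = - (2 * (a \<bullet> x - m) / (a \<bullet> a))"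
    unfolding inner_reflect[OF assms] minus_divide_left by (simp add: algebra_simps)
  then have "reflect a m (reflect a m x) = reflect a m x - (- (2 * (a \<bullet> x - m) / (a \<bullet> a))) *\<^sub>R a"
    by (simp only: reflect_def[of a m "reflect a m x"])
  then show ?thesis by (simp add: reflect_def)
qed

text \<open>The sign of the correction term compares the Gaussian density at a point and at its
  mirror image; for \<open>m = 0\<close> the term vanishes and the norm is preserved.\<close>

lemma norm_reflect:
  assumes "a \<noteq> 0"
  shows "(norm (reflect a m x))\<^sup>2 = (norm x)\<^sup>2 - 4 * m * (a \<bullet> x - m) / (a \<bullet> a)"
proof -
  define k where "k = 2 * (a \<bullet> x - m) / (a \<bullet> a)"
  have k: "k * (a \<bullet> a) = 2 * (a \<bullet> x - m)" using assms by (simp add: k_def)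
  have "(norm (reflect a m x))\<^sup>2 = x \<bullet> x - 2 * k * (a \<bullet> x) + k * (k * (a \<bullet> a))"
    unfolding power2_norm_eq_inner reflect_def k_def[symmetric]
    by (simp add: inner_diff_left inner_diff_right inner_commute[of x a] algebra_simps)
  also have "\<dots> = x \<bullet> x - 2 * m * k"
    unfolding k by (simp add: algebra_simps)
  finally show ?thesis by (simp add: k_def power2_norm_eq_inner)
qed

lemma dist_reflect: "a \<noteq> 0 \<Longrightarrow> dist (reflect a m x) (reflect a m y) = dist x y"
proof -
  assume a: "a \<noteq> 0"
  \<comment> \<open>The offset \<open>m\<close> cancels in differences, leaving the linear
    reflection.\<close>
  have "reflect a m x - reflect a m y = reflect a 0 (x - y)"
    by (simp add: reflect_def inner_diff_right algebra_simps diff_divide_distrib)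
  moreover have "norm (reflect a 0 (x - y)) = norm (x - y)"
    using norm_reflect[OF a, of 0 "x - y"] by simp
  ultimately show ?thesis by (simp add: dist_norm)
qed

lemma iso_normal_density_measurable [measurable]: "iso_normal_density \<sigma> \<in> borel_measurable borel"
  unfolding iso_normal_density_def[abs_def] by measurable

text \<open>The origin lies on the side \<open>a \<bullet> w \<le> m\<close>, so reflecting in the hyperplane \<open>a \<bullet> w = m\<close>
  moves points of the side \<open>a \<bullet> w < m\<close> away from the mode of the density.\<close>

lemma reflect_halfspace_le:
  fixes a :: "real ^ 'n" and F :: "real ^ 'n \<Rightarrow> ennreal"
  assumes a: "a \<noteq> 0" and m: "0 \<le> m" and [measurable]: "F \<in> borel_measurable borel"
    and F: "\<And>w. F (reflect a m w) = F w"
  shows "(\<integral>\<^sup>+w. ennreal (iso_normal_density \<sigma> w) * (if m < a \<bullet> w then F w else 0) \<partial>lborel)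
    \<le> (\<integral>\<^sup>+w. ennreal (iso_normal_density \<sigma> w) * (if a \<bullet> w < m then F w else 0) \<partial>lborel)"
    (is "(\<integral>\<^sup>+w. ?h w \<partial>lborel) \<le> _")
proof -
  let ?r = "reflect a m"
  have [measurable]: "?r \<in> borel_measurable borel"
    unfolding reflect_def[abs_def] by measurable
  \<comment> \<open>Substituting the reflection exchanges the two open half-spaces and leaves
    \<open>F\<close> unchanged, so only the densities remain to be compared.\<close>
  have "(\<integral>\<^sup>+w. ?h w \<partial>lborel) = (\<integral>\<^sup>+w. ?h w \<partial>distr lborel borel ?r)"
    by (subst distr_lborel_isometry[where g = ?r]) (simp_all add: a dist_reflect reflect_reflect)
  also have "\<dots> = (\<integral>\<^sup>+w. ?h (?r w) \<partial>lborel)"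
    by (rule nn_integral_distr) measurable
  also have "\<dots> \<le> (\<integral>\<^sup>+w. ennreal (iso_normal_density \<sigma> w) * (if a \<bullet> w < m then F w else 0) \<partial>lborel)"
  proof (rule nn_integral_mono)
    fix w
    have "iso_normal_density \<sigma> (?r w) \<le> iso_normal_density \<sigma> w" if "a \<bullet> w < m"
    proof -
      have "4 * m * (a \<bullet> w - m) / (a \<bullet> a) \<le> 0"
        using that m by (intro divide_nonpos_nonneg mult_nonneg_nonpos) auto
      then have "(norm w)\<^sup>2 \<le> (norm (?r w))\<^sup>2"
        using norm_reflect[OF a, of m w] by linarith
      then show ?thesis
        unfolding iso_normal_density_def
        by (intro mult_left_mono) (auto intro!: divide_right_mono)
    qed
    then show "?h (?r w) \<le> ennreal (iso_normal_density \<sigma> w) * (if a \<bullet> w < m then F w else 0)"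
      by (auto simp: inner_reflect[OF a] F intro!: mult_right_mono ennreal_leI)
  qed
  finally show ?thesis .
qed

subsection \<open>The least squares estimate of the augmented design\<close>

lemma matrix_diff_ldistrib: "A ** (B - C) = A ** B - A ** (C :: real ^ 'n ^ 'm)"
  by (simp add: matrix_matrix_mult_def vec_eq_iff right_diff_distrib sum_subtractf)

lemma matrix_diff_rdistrib: "(A - B) ** C = A ** C - B ** (C :: real ^ 'n ^ 'm)"
  by (simp add: matrix_matrix_mult_def vec_eq_iff left_diff_distrib sum_subtractf)

lemma transpose_diff: "transpose (A - B) = transpose A - transpose (B :: real ^ 'n ^ 'm)"
  by (simp add: transpose_def vec_eq_iff)

lemma matrix_inv_inverse:
  fixes A :: "real ^ 'n ^ 'n"
  assumes "invertible A"
  shows "A ** matrix_inv A = mat 1" "matrix_inv A ** A = mat 1"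
proof -
  have "A ** matrix_inv A = mat 1 \<and> matrix_inv A ** A = mat 1"
    unfolding matrix_inv_def by (rule someI_ex) (use assms in \<open>simp add: invertible_def\<close>)
  then show "A ** matrix_inv A = mat 1" "matrix_inv A ** A = mat 1" by auto
qed

text \<open>Least squares recovers the coefficients of any vector in the range of \<open>A\<close>.
  This applies both to the noiseless response and to shifts of the noise along a difference of
  columns.\<close>

lemma ols_mult:
  assumes "invertible (gram A)"
  shows "ols A (A *v z) = z"
proof -
  have "transpose A *v (A *v z) = gram A *v z"
    by (simp only: gram_def matrix_vector_mul_assoc)
  then show ?thesis
    unfolding ols_def by (simp only: matrix_vector_mul_assoc matrix_inv_inverse[OF assms]) simp
qed

lemma linear_ols: "linear (ols A)"
  unfolding ols_def[abs_def]
  by (rule linearI) (simp_all only: matrix_vector_right_distrib matrix_vector_mult_scaleR)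

lemma gram_ols:
  assumes "invertible (gram A)"
  shows "gram A *v ols A y = transpose A *v y"
  unfolding ols_def
  by (simp only: matrix_vector_mul_assoc matrix_mul_assoc matrix_inv_inverse[OF assms] matrix_mul_lid)

lemma inner_transpose: "x \<bullet> (transpose A *v y) = (A *v x) \<bullet> (y :: real ^ 'n)"
  by (simp add: dot_lmul_matrix inner_commute[of x] inner_commute[of "A *v x"])

lemma diag_mat_axis: "diag_mat s *v axis j 1 = s $ j *\<^sub>R axis j 1"
  by (simp add: matrix_vector_mult_basis) (simp add: column_def diag_mat_def axis_def vec_eq_iff)

lemma transpose_diag_mat: "transpose (diag_mat s) = diag_mat s"
  by (auto simp: transpose_def diag_mat_def vec_eq_iff)

text \<open>With \<open>E = X - Xt\<close>, orthogonality of \<open>U\<close> and \<open>X\<close>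
  gives the first identity. In \<open>transpose E ** E\<close> the term
  \<open>diag_mat s ** P\<close> cancels against the one in \<open>transpose C ** C\<close>, leaving
  twice \<open>diag_mat s\<close>; subtracting this from \<open>transpose X ** E\<close> gives the
  second.\<close>

lemma knockoff_matrix_cross:
  assumes inv: "invertible (gram X)" and K: "is_knockoff_factor X s U C"
  defines "Xt \<equiv> knockoff_matrix X s U C"
  shows "transpose X ** (X - Xt) = diag_mat s"
    and "transpose Xt ** (X - Xt) = - diag_mat s"
proof -
  define P where "P = matrix_inv (gram X) ** diag_mat s"
  define E where "E = X - Xt"
  have E: "E = X ** P - U ** C"
    unfolding E_def Xt_def knockoff_matrix_def P_def by (simp add: matrix_diff_ldistrib)
  have UX: "transpose U ** X = 0" and UU: "transpose U ** U = mat 1"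
    and CC: "transpose C ** C = 2 *\<^sub>R diag_mat s - diag_mat s ** P"
    using K by (auto simp: is_knockoff_factor_def P_def matrix_mul_assoc)
  have XU: "transpose X ** U = 0"
    using arg_cong[OF UX, of transpose]
    by (simp add: matrix_transpose_mul) (simp add: transpose_def vec_eq_iff)
  have GP: "transpose X ** (X ** P) = diag_mat s"
    unfolding P_def by (simp only: matrix_mul_assoc gram_def[symmetric] matrix_inv_inverse[OF inv]) simp
  have zero: "A ** (0 :: real^'c^'b) = 0" "(0 :: real^'b^'d) ** B = 0"
    for A :: "real^'b^'d" and B :: "real^'c^'b"
    by (simp_all add: matrix_matrix_mult_def vec_eq_iff)
  show XE: "transpose X ** (X - Xt) = diag_mat s"
    unfolding E_def[symmetric] E
    by (simp add: matrix_diff_ldistrib GP, simp add: matrix_mul_assoc XU zero)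
  have UE: "transpose U ** E = - C"
    unfolding E
    by (simp add: matrix_diff_ldistrib, simp add: matrix_mul_assoc UX UU zero)
  have "transpose E ** E = transpose P ** (transpose X ** E) - transpose C ** (transpose U ** E)"
    by (simp add: E matrix_transpose_mul transpose_diff matrix_diff_rdistrib matrix_mul_assoc)
  also have "\<dots> = transpose P ** diag_mat s + transpose C ** C"
    unfolding UE XE[folded E_def] by (simp add: matrix_matrix_mult_def vec_eq_iff sum_negf)
  also have "transpose P ** diag_mat s = diag_mat s ** P"
  proof -
    \<comment> \<open>Rewriting the product as the Gram matrix of \<open>X ** P\<close> yields the
      required symmetry without transposing the inverse of \<open>gram X\<close>.\<close>
    have "transpose P ** diag_mat s = transpose (X ** P) ** (X ** P)"
      by (simp only: GP[symmetric] matrix_transpose_mul matrix_mul_assoc)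
    also have "\<dots> = transpose (transpose X ** (X ** P)) ** P"
      by (simp add: matrix_transpose_mul matrix_mul_assoc)
    finally show ?thesis by (simp add: GP transpose_diag_mat)
  qed
  finally have EE: "transpose E ** E = 2 *\<^sub>R diag_mat s" by (simp add: CC)
  have "transpose Xt ** E = transpose X ** E - transpose E ** E"
    by (simp add: E_def transpose_diff matrix_diff_rdistrib)
  then show "transpose Xt ** (X - Xt) = - diag_mat s"
    unfolding E_def[symmetric] EE using XE by (simp add: E_def scaleR_2)
qed

lemma sum_UNIV_Plus:
  "(\<Sum>k\<in>(UNIV :: ('a::finite + 'b::finite) set). f k) = (\<Sum>i\<in>UNIV. f (Inl i)) + (\<Sum>j\<in>UNIV. (f (Inr j) :: 'c :: comm_monoid_add))"
  unfolding UNIV_Plus_UNIV[symmetric] by (subst sum.Plus) simp_all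

lemma hconcat_mult:
  "hconcat A B *v z = A *v (\<chi> j. z $ Inl j) + B *v (\<chi> j. z $ Inr j)"
  by (simp add: hconcat_def matrix_vector_mult_def vec_eq_iff sum_UNIV_Plus)

abbreviation contrast :: "'p::finite \<Rightarrow> real ^ ('p + 'p)" where
  "contrast j \<equiv> axis (Inl j) 1 - axis (Inr j) 1"

lemma hconcat_contrast: "hconcat X Xt *v contrast j = column j X - column j Xt"
  by (simp add: matrix_vector_mult_diff_distrib matrix_vector_mult_basis)
     (simp add: hconcat_def column_def vec_eq_iff)

text \<open>Stacking the \<open>j\<close>-th columns of the two cross products shows that the
  contrast is an eigenvector of the augmented Gram matrix with eigenvalue
  \<open>s $ j\<close>.\<close>

lemma transpose_hconcat_contrast:
  assumes "invertible (gram X)" "is_knockoff_factor X s U C" "Xt = knockoff_matrix X s U C"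
  shows "transpose (hconcat X Xt) *v (hconcat X Xt *v contrast j) = s $ j *\<^sub>R contrast j"
proof -
  have col: "column j X - column j Xt = (X - Xt) *v axis j 1"
    by (simp add: matrix_vector_mult_basis column_def vec_eq_iff)
  have "transpose X *v (column j X - column j Xt) = s $ j *\<^sub>R axis j 1"
    unfolding col matrix_vector_mul_assoc
    using knockoff_matrix_cross(1)[OF assms(1,2)] assms(3) by (simp add: diag_mat_axis)
  moreover have "transpose Xt *v (column j X - column j Xt) = - (s $ j *\<^sub>R axis j 1)"
    unfolding col matrix_vector_mul_assoc
    using knockoff_matrix_cross(2)[OF assms(1,2)] assms(3)
    by (simp add: diag_mat_axis[symmetric]) (simp add: matrix_vector_mult_def sum_negf vec_eq_iff)
  ultimately have "(transpose (hconcat X Xt) *v (column j X - column j Xt)) $ k =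
      (s $ j *\<^sub>R contrast j) $ k" for k
    by (cases k) (auto simp: vec_eq_iff matrix_vector_mult_def transpose_def hconcat_def axis_def
        simp del: transpose_matrix_vector split: if_splits)
  then show ?thesis unfolding hconcat_contrast by (subst vec_eq_iff) blast
qed

subsection \<open>Sign flips of null statistics\<close>

lemma knockoff_statistic_pos_iff: "knockoff_statistic W \<Longrightarrow> 0 < W b $ j \<longleftrightarrow> 0 < b $ Inl j - b $ Inr j"
  unfolding knockoff_statistic_def by (metis sgn_greater)

lemma knockoff_statistic_neg_iff: "knockoff_statistic W \<Longrightarrow> W b $ j < 0 \<longleftrightarrow> b $ Inl j - b $ Inr j < 0"
  unfolding knockoff_statistic_def by (metis sgn_less)

text \<open>Subtracting this multiple of the contrast exchanges the two entries of pair
  \<open>j\<close>. All unordered pairs, and the signs at other indices, are unchanged; the only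
  sign that can change is the one erased by \<open>abs_at j\<close>.\<close>

lemma abs_at_statistic_swap:
  assumes W: "knockoff_statistic W" and b': "b' = b - (b $ Inl j - b $ Inr j) *\<^sub>R contrast j"
  shows "abs_at j (W b') = abs_at j (W b)"
proof -
  have swap: "b' $ Inl k = (if k = j then b $ Inr j else b $ Inl k)"
    "b' $ Inr k = (if k = j then b $ Inl j else b $ Inr k)" for k
    by (auto simp: b' axis_def)
  have abs: "\<bar>W b' $ k\<bar> = \<bar>W b $ k\<bar>" for k
  proof -
    have "{b' $ Inl k, b' $ Inr k} = {b $ Inl k, b $ Inr k}"
      by (auto simp: swap)
    then show ?thesis using W unfolding knockoff_statistic_def by blast
  qed
  moreover have "W b' $ k = W b $ k" if "k \<noteq> j" for k
  proof -
    have "sgn (W b' $ k) = sgn (W b $ k)"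
      using W that by (simp add: knockoff_statistic_def swap)
    then show ?thesis
      using abs[of k] by (metis mult_sgn_abs)
  qed
  ultimately show ?thesis
    by (simp add: vec_eq_iff abs_at_nth)
qed

lemma ols_measurable [measurable]: "ols A \<in> borel_measurable borel"
  using linear_ols by (intro borel_measurable_continuous_onI linear_continuous_on) (simp add: linear_conv_bounded_linear)

text \<open>The contrast vectors are eigenvectors of the Gram matrix. Hence moving the noise along the
  \<open>j\<close>-th difference of columns changes the estimate only in the \<open>j\<close>-th pair, and the hyperplane
  where that pair is balanced is orthogonal to this direction.\<close>

lemma gram_contrast_direction:
  assumes inv: "invertible (gram A)"
    and eig: "transpose A *v (A *v e) = c *\<^sub>R e" and e: "e \<noteq> 0" and c: "0 \<le> c"
  shows "0 < c"
    and "(A *v e) \<bullet> (A *v e) = c * (e \<bullet> e)"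
    and "(A *v e) \<bullet> w = c * (e \<bullet> ols A w)"
proof -
  have ne: "A *v e \<noteq> 0"
    using ols_mult[OF inv, of e] e linear_0[OF linear_ols[of A]] by auto
  show norm: "(A *v e) \<bullet> (A *v e) = c * (e \<bullet> e)"
    by (simp only: inner_transpose[symmetric] eig inner_scaleR_right)
  have "0 < (A *v e) \<bullet> (A *v e)" using ne by simp
  then show "0 < c" unfolding norm using c by (auto simp: zero_less_mult_iff)
  have "(A *v e) \<bullet> w = e \<bullet> (gram A *v ols A w)"
    by (simp only: gram_ols[OF inv] inner_transpose)
  also have "\<dots> = (A *v e) \<bullet> (A *v ols A w)"
    by (simp only: gram_def matrix_vector_mul_assoc[symmetric] inner_transpose)
  also have "\<dots> = ols A w \<bullet> (transpose A *v (A *v e))"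
    by (simp only: inner_transpose inner_commute)
  finally show "(A *v e) \<bullet> w = c * (e \<bullet> ols A w)"
    by (simp only: eig inner_scaleR_right inner_commute)
qed

lemma inner_contrast: "contrast j \<bullet> z = z $ Inl j - z $ Inr j"
  by (simp add: inner_diff_left inner_axis')

text \<open>The sign \<epsilon> treats both one-sided procedures at once. The sign of the
  \<open>j\<close>-th statistic tells on which side of the hyperplane
  \<open>a \<bullet> w = m\<close> the noise lies, reflection swaps pair \<open>j\<close>, and the
  null hypothesis makes \<open>m\<close> nonnegative.\<close>

lemma null_flip_le:
  fixes X Xt U :: "real ^ 'p ^ 'n" and \<beta> \<delta> s :: "real ^ 'p"
  assumes inv: "invertible (gram X)" "invertible (gram (hconcat X Xt))"
    and K: "is_knockoff_factor X s U C" "Xt = knockoff_matrix X s U C"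
    and s: "0 \<le> s $ j" and W: "knockoff_statistic W"
    and \<epsilon>: "\<epsilon> * \<epsilon> = 1" and null: "\<epsilon> * \<beta> $ j \<le> \<delta> $ j"
  defines "b \<equiv> \<lambda>w. \<epsilon> *\<^sub>R ols (hconcat X Xt) (X *v \<beta> + w) + knockoff_shift \<delta>"
  shows "(\<integral>\<^sup>+w. ennreal (iso_normal_density \<sigma> w) * (if 0 < W (b w) $ j then ennreal (flip_weight \<tau> H j (W (b w))) else 0) \<partial>lborel)
    \<le> (\<integral>\<^sup>+w. ennreal (iso_normal_density \<sigma> w) * (if W (b w) $ j < 0 then ennreal (flip_weight \<tau> H j (W (b w))) else 0) \<partial>lborel)"
proof -
  let ?A = "hconcat X Xt" and ?e = "contrast j :: real ^ ('p + 'p)"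
  define a where "a = \<epsilon> *\<^sub>R (?A *v ?e)"
  define m where "m = s $ j * (\<delta> $ j - \<epsilon> * \<beta> $ j)"
  define D where "D w = b w $ Inl j - b w $ Inr j" for w
  have ee: "?e \<bullet> ?e = 2"
    by (simp add: inner_contrast, simp add: axis_def)
  then have e0: "?e \<noteq> 0" by auto
  note dir = gram_contrast_direction[OF inv(2) transpose_hconcat_contrast[OF inv(1) K] e0 s]
  have s_pos: "0 < s $ j" by (rule dir(1))
  \<comment> \<open>The noiseless response lies in the range of the augmented design, with zero
    knockoff coefficients.\<close>
  have "X *v \<beta> = ?A *v (\<chi> k. case k of Inl i \<Rightarrow> \<beta> $ i | Inr i \<Rightarrow> 0)"
    by (simp add: hconcat_mult zero_vec_def[symmetric])
  then have ols: "ols ?A (X *v \<beta> + w) = (\<chi> k. case k of Inl i \<Rightarrow> \<beta> $ i | Inr i \<Rightarrow> 0) + ols ?A w" for w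
    by (simp add: linear_add[OF linear_ols] ols_mult[OF inv(2)])
  have D: "s $ j * D w = a \<bullet> w - m" for w
  proof -
    have aw: "a \<bullet> w = \<epsilon> * (s $ j * (ols ?A w $ Inl j - ols ?A w $ Inr j))"
      by (simp only: a_def inner_scaleR_left dir(3) inner_contrast)
    have Dw: "D w = \<epsilon> * (\<beta> $ j + ols ?A w $ Inl j) - (\<epsilon> * ols ?A w $ Inr j + \<delta> $ j)"
      unfolding D_def b_def ols by (simp add: knockoff_shift_def)
    show ?thesis unfolding aw Dw m_def by (simp add: algebra_simps)
  qed
  have aa: "a \<bullet> a = 2 * s $ j"
    by (simp add: a_def dir(2) ee \<epsilon> mult.assoc[symmetric])
  then have a0: "a \<noteq> 0" using s_pos by auto
  \<comment> \<open>The factor 2 in \<open>a \<bullet> a\<close> cancels the 2 of the reflection, so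
    the noise moves by exactly \<open>D w\<close> times \<open>a\<close>.\<close>
  have refl: "reflect a m w = w - D w *\<^sub>R a" for w
    using s_pos unfolding reflect_def aa D[symmetric] by simp
  have "b (reflect a m w) = b w - D w *\<^sub>R ?e" for w
  proof -
    have step: "ols ?A (w - D w *\<^sub>R a) = ols ?A w - (D w * \<epsilon>) *\<^sub>R ?e"
      by (simp only: a_def scaleR_scaleR linear_diff[OF linear_ols] linear_scale[OF linear_ols] ols_mult[OF inv(2)])
    \<comment> \<open>One \<epsilon> comes from \<open>a\<close>, the other from the estimate; their
      product is 1, so the pair is swapped for either sign.\<close>
    have \<epsilon>D: "\<epsilon> * (D w * \<epsilon>) = D w" using \<epsilon> by (simp add: mult.left_commute)
    show ?thesis
      unfolding b_def ols refl step scaleR_diff_right scaleR_add_right scaleR_scaleR \<epsilon>D by simp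
  qed
  then have swap: "abs_at j (W (b (reflect a m w))) = abs_at j (W (b w))" for w
    by (intro abs_at_statistic_swap[OF W]) (simp add: D_def)
  have pos: "0 < W (b w) $ j \<longleftrightarrow> m < a \<bullet> w" and neg: "W (b w) $ j < 0 \<longleftrightarrow> a \<bullet> w < m" for w
    using s_pos D[of w] unfolding knockoff_statistic_pos_iff[OF W] knockoff_statistic_neg_iff[OF W] D_def[symmetric]
    by (metis diff_gt_0_iff_gt zero_less_mult_pos mult_pos_pos, metis diff_less_0_iff_less mult_less_0_iff not_less_iff_gr_or_eq)
  have [measurable]: "W \<in> borel_measurable borel"
    using W by (simp add: knockoff_statistic_def)
  show ?thesis
    unfolding pos neg
  proof (rule reflect_halfspace_le[OF a0])
    show "0 \<le> m" using s null by (simp add: m_def)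
    show "(\<lambda>w. ennreal (flip_weight \<tau> H j (W (b w)))) \<in> borel_measurable borel"
      unfolding b_def by measurable
    show "ennreal (flip_weight \<tau> H j (W (b (reflect a m w)))) = ennreal (flip_weight \<tau> H j (W (b w)))" for w
      by (simp only: flip_weight_cong[OF swap])
  qed
qed

text \<open>By linearity each null summand is flipped separately from plus to minus; the summands
  are then recombined under one integral, where the pointwise bound 1 for negative signs
  applies.\<close>

lemma expected_positive_flip_weight_le:
  fixes X Xt U :: "real ^ 'p ^ 'n" and \<beta> \<delta> s :: "real ^ 'p"
  assumes M: "prob_space M" and w: "distributed M lborel w (\<lambda>x. ennreal (iso_normal_density \<sigma> x))"
    and inv: "invertible (gram X)" "invertible (gram (hconcat X Xt))"
    and K: "is_knockoff_factor X s U C" "Xt = knockoff_matrix X s U C"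
    and s: "\<And>j. 0 \<le> s $ j" and W: "knockoff_statistic W"
    and \<epsilon>: "\<epsilon> * \<epsilon> = 1"
  defines "b \<equiv> \<lambda>w. \<epsilon> *\<^sub>R ols (hconcat X Xt) (X *v \<beta> + w) + knockoff_shift \<delta>"
    and "H \<equiv> {j. \<epsilon> * \<beta> $ j \<le> \<delta> $ j}"
  shows "(\<lambda>\<omega>. \<Sum>j\<in>H. if 0 < W (b (w \<omega>)) $ j then flip_weight \<tau> H j (W (b (w \<omega>))) else 0) \<in> borel_measurable M"
    and "(\<integral>\<^sup>+\<omega>. ennreal (\<Sum>j\<in>H. if 0 < W (b (w \<omega>)) $ j then flip_weight \<tau> H j (W (b (w \<omega>))) else 0) \<partial>M) \<le> 1"
proof -
  interpret prob_space M by fact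
  have [measurable]: "W \<in> borel_measurable borel"
    using W by (simp add: knockoff_statistic_def)
  have [measurable]: "w \<in> borel_measurable M"
    using distributed_measurable[OF w] by simp
  have [measurable]: "b \<in> borel_measurable borel"
    unfolding b_def by measurable
  show "(\<lambda>\<omega>. \<Sum>j\<in>H. if 0 < W (b (w \<omega>)) $ j then flip_weight \<tau> H j (W (b (w \<omega>))) else 0) \<in> borel_measurable M"
    by measurable
  define P where "P j x = (if 0 < W (b x) $ j then ennreal (flip_weight \<tau> H j (W (b x))) else 0)" for j x
  define N where "N j x = (if W (b x) $ j < 0 then ennreal (flip_weight \<tau> H j (W (b x))) else 0)" for j x
  have [measurable]: "P j \<in> borel_measurable borel" "N j \<in> borel_measurable borel" for j
    unfolding P_def N_def by measurable
  have "(\<integral>\<^sup>+\<omega>. ennreal (\<Sum>j\<in>H. if 0 < W (b (w \<omega>)) $ j then flip_weight \<tau> H j (W (b (w \<omega>))) else 0) \<partial>M)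
      = (\<integral>\<^sup>+\<omega>. (\<Sum>j\<in>H. P j (w \<omega>)) \<partial>M)"
  proof (rule nn_integral_cong)
    fix \<omega>
    show "ennreal (\<Sum>j\<in>H. if 0 < W (b (w \<omega>)) $ j then flip_weight \<tau> H j (W (b (w \<omega>))) else 0) = (\<Sum>j\<in>H. P j (w \<omega>))"
      by (subst sum_ennreal[symmetric]) (simp add: flip_weight_nonneg, rule sum.cong, auto simp: P_def)
  qed
  also have "\<dots> = (\<Sum>j\<in>H. \<integral>\<^sup>+\<omega>. P j (w \<omega>) \<partial>M)"
    by (rule nn_integral_sum) measurable
  also have "\<dots> \<le> (\<Sum>j\<in>H. \<integral>\<^sup>+\<omega>. N j (w \<omega>) \<partial>M)"
  proof (rule sum_mono)
    fix j assume "j \<in> H"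
    then have "(\<integral>\<^sup>+x. ennreal (iso_normal_density \<sigma> x) * P j x \<partial>lborel)
        \<le> (\<integral>\<^sup>+x. ennreal (iso_normal_density \<sigma> x) * N j x \<partial>lborel)"
      unfolding P_def N_def b_def by (intro null_flip_le[OF inv K s W \<epsilon>]) (simp add: H_def)
    then show "(\<integral>\<^sup>+\<omega>. P j (w \<omega>) \<partial>M) \<le> (\<integral>\<^sup>+\<omega>. N j (w \<omega>) \<partial>M)"
      by (simp add: distributed_nn_integral[OF w, symmetric])
  qed
  also have "\<dots> = (\<integral>\<^sup>+\<omega>. (\<Sum>j\<in>H. N j (w \<omega>)) \<partial>M)"
    by (rule nn_integral_sum[symmetric]) measurable
  also have "\<dots> \<le> (\<integral>\<^sup>+\<omega>. 1 \<partial>M)"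
  proof (rule nn_integral_mono)
    fix \<omega>
    have "(\<Sum>j\<in>H. N j (w \<omega>)) = ennreal (\<Sum>j\<in>H. if W (b (w \<omega>)) $ j < 0 then flip_weight \<tau> H j (W (b (w \<omega>))) else 0)"
      by (subst sum_ennreal[symmetric]) (simp add: flip_weight_nonneg, rule sum.cong, auto simp: N_def)
    then show "(\<Sum>j\<in>H. N j (w \<omega>)) \<le> 1"
      using sum_negative_flip_weight_le[of "W (b (w \<omega>))" \<tau> H] by (simp add: ennreal_le_1)
  qed
  finally show "(\<integral>\<^sup>+\<omega>. ennreal (\<Sum>j\<in>H. if 0 < W (b (w \<omega>)) $ j then flip_weight \<tau> H j (W (b (w \<omega>))) else 0) \<partial>M) \<le> 1"
    by (simp add: emeasure_space_1)
qed

theorem corollary1: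
  fixes M :: "'a measure"
    and X Xt U :: "real ^ 'p ^ 'n"
    and C :: "real ^ 'p ^ 'p"
    and s \<beta> \<delta> :: "real ^ 'p"
    and \<sigma> q :: real
    and w y :: "'a \<Rightarrow> real ^ 'n"
    and b_ols :: "'a \<Rightarrow> real ^ ('p + 'p)"
    and W' W'' :: "real ^ ('p + 'p) \<Rightarrow> real ^ 'p"
    and R' R'' :: "'a \<Rightarrow> 'p set"
    and H0' H0'' :: "'p set"
  assumes "prob_space M"
    and "\<sigma>\<^sup>2 > 0"
    and "distributed M lborel w (\<lambda>x. ennreal (iso_normal_density \<sigma> x))"
    and "\<And>\<omega>. y \<omega> = X *v \<beta> + w \<omega>"
    and "CARD('n) \<ge> 2 * CARD('p)"
    and "\<And>j. norm (column j X) = 1"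
    and "invertible (gram X)"
    and "\<And>j. s $ j \<ge> 0"
    and "loewner_le (diag_mat s) (2 *\<^sub>R gram X)"
    and "is_knockoff_factor X s U C"
    and "Xt = knockoff_matrix X s U C"
    and "invertible (gram (hconcat X Xt))"
    and "\<And>\<omega>. b_ols \<omega> = ols (hconcat X Xt) (y \<omega>)"
    and "0 \<le> q" and "q \<le> 1"
    and "\<And>j. \<delta> $ j \<ge> 0"
    and "knockoff_statistic W'"
    and "knockoff_statistic W''"
    and "\<And>\<omega>. R' \<omega> = knockoff_select (q / 2) (W' (b_ols \<omega> + knockoff_shift \<delta>))"
    and "\<And>\<omega>. R'' \<omega> = knockoff_select (q / 2) (W'' (- b_ols \<omega> + knockoff_shift \<delta>))"
    and "H0' = {j. \<beta> $ j \<le> \<delta> $ j}"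
    and "H0'' = {j. \<beta> $ j \<ge> - \<delta> $ j}"
  shows "fdr M (\<lambda>\<omega>. R' \<omega> \<union> R'' \<omega>) (H0' \<inter> H0'') \<le> q"
proof -
  let ?b = "\<lambda>\<epsilon> \<omega>. \<epsilon> *\<^sub>R ols (hconcat X Xt) (X *v \<beta> + w \<omega>) + knockoff_shift \<delta>"
  define S where "S W \<epsilon> H \<omega> =
      (\<Sum>j\<in>H. if 0 < W (?b \<epsilon> \<omega>) $ j then flip_weight (q / 2) H j (W (?b \<epsilon> \<omega>)) else 0)"
    for W :: "real ^ ('p + 'p) \<Rightarrow> real ^ 'p" and \<epsilon> H \<omega>
  \<comment> \<open>The second null set takes the form of the first with \<epsilon> = -1, so the
    same bound serves both procedures.\<close>
  have H: "H0' = {j. 1 * \<beta> $ j \<le> \<delta> $ j}" "H0'' = {j. - 1 * \<beta> $ j \<le> \<delta> $ j}"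
    using assms(21,22) by auto
  note one_sided = expected_positive_flip_weight_le[OF assms(1,3,7,12,10,11,8)]
  have S': "S W' 1 H0' \<in> borel_measurable M" "(\<integral>\<^sup>+\<omega>. ennreal (S W' 1 H0' \<omega>) \<partial>M) \<le> 1"
    unfolding S_def[abs_def] H using one_sided[OF assms(17), of 1] by simp_all
  have S'': "S W'' (- 1) H0'' \<in> borel_measurable M" "(\<integral>\<^sup>+\<omega>. ennreal (S W'' (- 1) H0'' \<omega>) \<partial>M) \<le> 1"
    unfolding S_def[abs_def] H using one_sided[OF assms(18), of "- 1"] by simp_all
  have S_nonneg: "0 \<le> S W \<epsilon> H \<omega>" for W \<epsilon> H \<omega>
    by (auto simp: S_def flip_weight_nonneg intro!: sum_nonneg)
  have fdp_le: "fdp (R' \<omega> \<union> R'' \<omega>) (H0' \<inter> H0'') \<le> q / 2 * S W' 1 H0' \<omega> + q / 2 * S W'' (- 1) H0'' \<omega>" for \<omega>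
    using fdp_knockoff_select_le[of "q / 2" "W' (?b 1 \<omega>)" H0']
      fdp_knockoff_select_le[of "q / 2" "W'' (?b (- 1) \<omega>)" H0''] assms(14)
    by (intro order_trans[OF fdp_Un_le add_mono]) (simp_all add: S_def assms(4,13,19,20))
  have "(\<integral>\<^sup>+\<omega>. ennreal (fdp (R' \<omega> \<union> R'' \<omega>) (H0' \<inter> H0'')) \<partial>M)
      \<le> (\<integral>\<^sup>+\<omega>. ennreal (q / 2) * ennreal (S W' 1 H0' \<omega>) + ennreal (q / 2) * ennreal (S W'' (- 1) H0'' \<omega>) \<partial>M)"
    using fdp_le assms(14) S_nonneg
    by (intro nn_integral_mono) (simp add: ennreal_mult[symmetric] ennreal_plus[symmetric] ennreal_leI del: ennreal_plus)
  also have "\<dots> = ennreal (q / 2) * (\<integral>\<^sup>+\<omega>. ennreal (S W' 1 H0' \<omega>) \<partial>M)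
      + ennreal (q / 2) * (\<integral>\<^sup>+\<omega>. ennreal (S W'' (- 1) H0'' \<omega>) \<partial>M)"
    using S'(1) S''(1) by (simp add: nn_integral_add nn_integral_cmult)
  also have "\<dots> \<le> ennreal (q / 2) * 1 + ennreal (q / 2) * 1"
    by (intro add_mono mult_left_mono S'(2) S''(2)) auto
  also have "\<dots> = ennreal q"
    using assms(14) by (simp add: ennreal_plus[symmetric] del: ennreal_plus)
  \<comment> \<open>A nonnegative real bound on the nonnegative integral also bounds the Bochner
    integral defining \<open>fdr\<close>.\<close>
  finally show ?thesis
    unfolding fdr_def using assms(14) by (rule integral_real_bounded[rotated])
qed

end
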